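(* Let $W(x)\in\mathbb{R}^{p\times p}[x]$ be a monic matrix polynomial of degree $N$, and let $P^{[i]}(x)$ and $\hat P^{[i]}(x)$, $i=1,2$, be the semi-infinite vectors of monic matrix bi-orthogonal polynomials of $d\mu(x)$ and $W(x)d\mu(x)$, respectively. With the connection matrices $\omega^{[1]}:=\hat S_1W(\Lambda)S_1^{-1}$ and $\omega^{[2]}:=(S_2\hat S_2^{-1})^\top$, one has $$\omega^{[1]}P^{[1]}(x)=\hat P^{[1]}(x)W(x),\qquad P^{[2]}(x)=(\omega^{[2]})^\top\hat P^{[2]}(x).$$
   Context: Let $\mu$ be a $p\times p$ matrix of Borel measures on $\mathbb{R}$ with finite moments $m_n=\int x^n d\mu(x)$, and $M=(m_{i+j})_{i,j\ge0}$. Assume $M=S_1^{-1}HS_2^{-\top}$ and $\hat M:=\left(\int x^{i+j}W(x)d\mu(x)\right)_{i,j\ge0}=\hat S_1^{-1}\hat H\hat S_2^{-\top}$, where $S_i,\hat S_i$ are semi-infinite lower unitriangular block matrices (blocks $p\times p$, diagonal blocks $I_p$) and $H,\hat H$ are block diagonal with nonsingular $p\times p$ diagonal blocks $H_k,\hat H_k$. With $\chi(x)=[I_p,I_px,I_px^2,\dots]^\top$ (block column), $P^{[i]}(x)=[P_0^{[i]},P_1^{[i]},\dots]^\top:=S_i\chi(x)$ and $\hat P^{[i]}(x):=\hat S_i\chi(x)$, $i=1,2$. $\Lambda$ is the semi-infinite block shift matrix (blocks $I_p$ on the first block superdiagonal, zero elsewhere); for $W(x)=\sum_jA_jx^j$,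 $W(\Lambda):=\sum_jA_j\Lambda^j$ with $A_j$ acting as $\mathrm{diag}(A_j,A_j,\dots)$. *)

theory Defs
  imports
    "HOL-Analysis.Analysis"
    "HOL-Computational_Algebra.Polynomial"
    "HOL-Library.Groups_Big_Fun"
begin

section \<open>Matrices of Borel measures\<close>

text \<open>
  An entry of the matrix of measures is a finite real (signed) Borel measure, represented by its
  values on Borel sets. Since the moments, in particular the total mass, are finite, this covers
  nonnegative Borel measures as well. Values on sets that are not Borel are irrelevant.
\<close>

definition signed_borel_measure :: "(real set \<Rightarrow> real) \<Rightarrow> bool" where
  "signed_borel_measure \<nu> \<longleftrightarrow>
     (\<forall>A :: nat \<Rightarrow> real set. range A \<subseteq> sets borel \<longrightarrow> disjoint_family A \<longrightarrow>
        (\<lambda>n. \<nu> (A n)) sums \<nu> (\<Union>n. A n))"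

text \<open>
  The upper variation of \<open>\<nu>\<close>; the lower variation is the upper variation of \<open>- \<nu>\<close>. The supremum is
  at least 0 because of \<open>B = {}\<close>. The two variations form the Jordan decomposition of \<open>\<nu>\<close>.
\<close>

definition upper_variation :: "(real set \<Rightarrow> real) \<Rightarrow> real measure" where
  "upper_variation \<nu> = measure_of UNIV (sets borel)
     (\<lambda>A. SUP B\<in>{B \<in> sets borel. B \<subseteq> A}. ennreal (\<nu> B))"

definition signed_integrable :: "(real set \<Rightarrow> real) \<Rightarrow> (real \<Rightarrow> real) \<Rightarrow> bool" where
  "signed_integrable \<nu> f \<longleftrightarrow>
     integrable (upper_variation \<nu>) f \<and> integrable (upper_variation (\<lambda>A. - \<nu> A)) f"

definition signed_integral :: "(real set \<Rightarrow> real) \<Rightarrow> (real \<Rightarrow> real) \<Rightarrow> real" where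
  "signed_integral \<nu> f =
     integral\<^sup>L (upper_variation \<nu>) f - integral\<^sup>L (upper_variation (\<lambda>A. - \<nu> A)) f"

definition matrix_measure :: "(real set \<Rightarrow> real)^'p^'p \<Rightarrow> bool" where
  "matrix_measure \<mu> \<longleftrightarrow> (\<forall>a b. signed_borel_measure (\<mu> $ a $ b))"

definition finite_moments :: "(real set \<Rightarrow> real)^'p^'p \<Rightarrow> bool" where
  "finite_moments \<mu> \<longleftrightarrow> (\<forall>a b n. signed_integrable (\<mu> $ a $ b) (\<lambda>x. x ^ n))"

text \<open>The integral of \<open>F(x) d\<mu>(x)\<close>, with the matrix product of \<open>F(x)\<close> and \<open>d\<mu>(x)\<close>.\<close>

definition matrix_integral ::
    "(real set \<Rightarrow> real)^'p^'p \<Rightarrow> (real \<Rightarrow> real^'p^'p) \<Rightarrow> real^'p^'p" where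
  "matrix_integral \<mu> F = (\<chi> a b. \<Sum>c\<in>UNIV. signed_integral (\<mu> $ c $ b) (\<lambda>x. F x $ a $ c))"


section \<open>Matrix polynomials\<close>

text \<open>
  Matrix polynomials are polynomials with matrix coefficients. Multiplication on \<open>real^'p^'p\<close> is
  componentwise, so the library functions \<open>poly\<close> and \<open>monic\<close> would be wrong here.
\<close>

definition mpoly_eval :: "(real^'p^'p) poly \<Rightarrow> real \<Rightarrow> real^'p^'p" where
  "mpoly_eval W x = (\<Sum>j\<le>degree W. x ^ j *\<^sub>R coeff W j)"

definition monic_mpoly :: "(real^'p^'p) poly \<Rightarrow> nat \<Rightarrow> bool" where
  "monic_mpoly W N \<longleftrightarrow> degree W = N \<and> coeff W N = mat 1"


section \<open>Semi-infinite block matrices\<close>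

type_synonym 'p block_matrix = "nat \<Rightarrow> nat \<Rightarrow> real^'p^'p"
type_synonym 'p block_vector = "nat \<Rightarrow> real^'p^'p"

text \<open>
  Products are finite sums: \<open>Sum_any\<close> adds up the nonzero terms, of which there are finitely many
  in all products of triangular and banded matrices considered here.
\<close>

definition bmult :: "'p::finite block_matrix \<Rightarrow> 'p block_matrix \<Rightarrow> 'p block_matrix"
    (infixl \<open>\<odot>\<close> 70) where
  "A \<odot> B = (\<lambda>i j. Sum_any (\<lambda>k. A i k ** B k j))"

definition bmult_vec :: "'p::finite block_matrix \<Rightarrow> 'p block_vector \<Rightarrow> 'p block_vector"
    (infixl \<open>\<odot>v\<close> 70) where
  "A \<odot>v v = (\<lambda>i. Sum_any (\<lambda>k. A i k ** v k))"

definition bident :: "'p::finite block_matrix" where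
  "bident i j = (if i = j then mat 1 else 0)"

definition btranspose :: "'p::finite block_matrix \<Rightarrow> 'p block_matrix" where
  "btranspose A = (\<lambda>i j. transpose (A j i))"

text \<open>The two-sided inverse, which exists and is unique for lower unitriangular block matrices.\<close>

definition binverse :: "'p::finite block_matrix \<Rightarrow> 'p block_matrix" where
  "binverse A = (THE B. A \<odot> B = bident \<and> B \<odot> A = bident)"

definition lower_unitriangular :: "'p::finite block_matrix \<Rightarrow> bool" where
  "lower_unitriangular S \<longleftrightarrow> (\<forall>i. S i i = mat 1) \<and> (\<forall>i j. i < j \<longrightarrow> S i j = 0)"

definition block_diagonal_nonsingular :: "'p::finite block_matrix \<Rightarrow> bool" where
  "block_diagonal_nonsingular H \<longleftrightarrow> (\<forall>i. invertible (H i i)) \<and> (\<forall>i j. i \<noteq> j \<longrightarrow> H i j = 0)"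

definition bshift :: "'p::finite block_matrix" where
  "bshift i j = (if j = Suc i then mat 1 else 0)"

primrec bpower :: "'p::finite block_matrix \<Rightarrow> nat \<Rightarrow> 'p block_matrix" where
  "bpower A 0 = bident"
| "bpower A (Suc n) = A \<odot> bpower A n"

definition bdiag :: "real^'p^'p \<Rightarrow> 'p::finite block_matrix" where
  "bdiag A i j = (if i = j then A else 0)"

definition mpoly_shift :: "(real^'p^'p) poly \<Rightarrow> 'p::finite block_matrix" where
  "mpoly_shift W = (\<lambda>i k. \<Sum>j\<le>degree W. (bdiag (coeff W j) \<odot> bpower bshift j) i k)"

definition monomials :: "real \<Rightarrow> 'p::finite block_vector" where
  "monomials x = (\<lambda>n. x ^ n *\<^sub>R mat 1)"


section \<open>Moment matrices\<close>

definition moment_matrix :: "(real set \<Rightarrow> real)^'p^'p \<Rightarrow> 'p::finite block_matrix" where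
  "moment_matrix \<mu> = (\<lambda>i j. matrix_integral \<mu> (\<lambda>x. x ^ (i + j) *\<^sub>R mat 1))"

definition perturbed_moment_matrix ::
    "(real^'p^'p) poly \<Rightarrow> (real set \<Rightarrow> real)^'p^'p \<Rightarrow> 'p::finite block_matrix" where
  "perturbed_moment_matrix W \<mu> =
     (\<lambda>i j. matrix_integral \<mu> (\<lambda>x. x ^ (i + j) *\<^sub>R mpoly_eval W x))"

definition gauss_borel ::
    "'p::finite block_matrix \<Rightarrow> 'p block_matrix \<Rightarrow> 'p block_matrix \<Rightarrow> 'p block_matrix \<Rightarrow> bool" where
  "gauss_borel M S\<^sub>1 H S\<^sub>2 \<longleftrightarrow>
     lower_unitriangular S\<^sub>1 \<and> lower_unitriangular S\<^sub>2 \<and> block_diagonal_nonsingular H \<and>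
     M = binverse S\<^sub>1 \<odot> H \<odot> btranspose (binverse S\<^sub>2)"


section \<open>Consistency of the definitions\<close>

lemma emeasure_upper_variation:
  assumes \<nu>: "signed_borel_measure \<nu>" and A: "A \<in> sets borel"
  shows "emeasure (upper_variation \<nu>) A = (SUP B\<in>{B \<in> sets borel. B \<subseteq> A}. ennreal (\<nu> B))"
proof -
  define f where "f A = (SUP B\<in>{B \<in> sets borel. B \<subseteq> A}. ennreal (\<nu> B))" for A
  have f_ub: "ennreal (\<nu> B) \<le> f A" if "B \<in> sets borel" "B \<subseteq> A" for A B
    unfolding f_def using that by (auto intro: SUP_upper)
  have sums: "(\<lambda>n. \<nu> (A n)) sums \<nu> (\<Union>n. A n)"
    if "range A \<subseteq> sets borel" "disjoint_family A" for A
    using \<nu> that by (simp add: signed_borel_measure_def)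
  have "(\<lambda>n::nat. \<nu> {}) sums \<nu> (\<Union>n::nat. {})"
    by (rule sums) (simp_all add: disjoint_family_on_def)
  hence "summable (\<lambda>n::nat. \<nu> {})" by (rule sums_summable)
  hence \<nu>_empty: "\<nu> {} = 0" using summable_LIMSEQ_zero LIMSEQ_const_iff by blast
  have f_empty: "f {} = 0"
  proof -
    have "{B \<in> sets borel. B \<subseteq> {}} = {{} :: real set}" by auto
    thus ?thesis unfolding f_def by (simp add: \<nu>_empty)
  qed
  have f_mono: "f A \<le> f B" if "A \<subseteq> B" for A B
    unfolding f_def using that by (intro SUP_subset_mono) auto
  have add: "\<nu> (B \<union> C) = \<nu> B + \<nu> C"
    if "B \<in> sets borel" "C \<in> sets borel" "B \<inter> C = {}" for B C
  proof -
    have 1: "(\<lambda>n. \<nu> (binaryset B C n)) sums \<nu> (\<Union>n. binaryset B C n)"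
    proof (rule sums)
      show "range (binaryset B C) \<subseteq> sets borel" using that by (simp add: range_binaryset_eq)
      show "disjoint_family (binaryset B C)"
        using that(3) by (simp add: disjoint_family_on_def binaryset_def Int_commute)
    qed
    have 2: "(\<lambda>n. \<nu> (binaryset B C n)) sums (\<nu> B + \<nu> C)"
      by (rule binaryset_sums) (rule \<nu>_empty)
    show ?thesis using sums_unique2[OF 1 2] by (simp add: UN_binaryset_eq)
  qed
  have superadd: "f A + f B \<le> f (A \<union> B)" if "A \<inter> B = {}" for A B
  proof -
    have ne: "{B \<in> sets borel. B \<subseteq> A} \<noteq> {}" for A :: "real set" by auto
    have step: "ennreal (\<nu> C) + ennreal (\<nu> D) \<le> f (A \<union> B)"
      if C: "C \<in> sets borel" "C \<subseteq> A" and D: "D \<in> sets borel" "D \<subseteq> B" for C D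
    proof -
      have c: "ennreal (\<nu> C) \<le> f (A \<union> B)" and d: "ennreal (\<nu> D) \<le> f (A \<union> B)"
        using C D by (auto intro: f_ub)
      have cd: "ennreal (\<nu> C + \<nu> D) \<le> f (A \<union> B)"
      proof -
        have "C \<inter> D = {}" "C \<union> D \<subseteq> A \<union> B" using C D \<open>A \<inter> B = {}\<close> by auto
        thus ?thesis using f_ub[of "C \<union> D" "A \<union> B"] add[of C D] C D by simp
      qed
      show ?thesis
      proof (cases "\<nu> C \<ge> 0 \<and> \<nu> D \<ge> 0")
        case True
        thus ?thesis using cd by simp
      next
        case False
        thus ?thesis using c d by (auto simp: ennreal_neg)
      qed
    qed
    have "ennreal (\<nu> C) + f B \<le> f (A \<union> B)" if C: "C \<in> sets borel" "C \<subseteq> A" for C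
    proof -
      have "ennreal (\<nu> C) + f B =
          (SUP D\<in>{B' \<in> sets borel. B' \<subseteq> B}. ennreal (\<nu> C) + ennreal (\<nu> D))"
        unfolding f_def using ne[of B] by (rule ennreal_SUP_add_right)
      also have "\<dots> \<le> f (A \<union> B)" using C step by (auto intro: SUP_least)
      finally show ?thesis .
    qed
    moreover have "f A + f B = (SUP C\<in>{B' \<in> sets borel. B' \<subseteq> A}. ennreal (\<nu> C) + f B)"
      unfolding f_def[of A] using ne[of A] by (rule ennreal_SUP_add_left[symmetric])
    ultimately show ?thesis by (auto intro: SUP_least)
  qed
  have "countably_additive (sets borel) f"
  proof (rule countably_additiveI)
    fix A :: "nat \<Rightarrow> real set"
    assume A: "range A \<subseteq> sets borel" "disjoint_family A"
    show "(suminf (\<lambda>n. f (A n))) = f (\<Union>n. A n)"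
    proof (rule antisym)
      have "(\<Sum>n<N. f (A n)) \<le> f (\<Union>n<N. A n)" for N
      proof (induction N)
        case (Suc N)
        have "(\<Union>n<N. A n) \<inter> A N = {}"
          using A(2) by (auto simp: disjoint_family_on_def dest: less_imp_neq)
        have "(\<Sum>n<Suc N. f (A n)) \<le> f (\<Union>n<N. A n) + f (A N)"
          using add_right_mono[OF Suc.IH] by simp
        also have "\<dots> \<le> f ((\<Union>n<N. A n) \<union> A N)"
          using \<open>(\<Union>n<N. A n) \<inter> A N = {}\<close> by (rule superadd)
        also have "(\<Union>n<N. A n) \<union> A N = (\<Union>n<Suc N. A n)"
          by (simp add: lessThan_Suc Un_commute)
        finally show ?case .
      qed (simp add: f_empty)
      also have "f (\<Union>n<N. A n) \<le> f (\<Union>n. A n)" for N by (rule f_mono) auto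
      finally show "(suminf (\<lambda>n. f (A n))) \<le> f (\<Union>n. A n)" by (intro suminf_le_const) auto
    next
      have "ennreal (\<nu> B) \<le> (suminf (\<lambda>n. f (A n)))" if B: "B \<in> sets borel" "B \<subseteq> (\<Union>n. A n)" for B
      proof -
        have "range (\<lambda>n. B \<inter> A n) \<subseteq> sets borel" "disjoint_family (\<lambda>n. B \<inter> A n)"
          using A B by (auto simp: disjoint_family_on_def)
        hence "(\<lambda>n. \<nu> (B \<inter> A n)) sums \<nu> (\<Union>n. B \<inter> A n)"
          by (rule sums)
        moreover have "(\<Union>n. B \<inter> A n) = B" using B by auto
        ultimately have "(\<lambda>N. \<Sum>n<N. \<nu> (B \<inter> A n)) \<longlonglongrightarrow> \<nu> B" by (simp add: sums_def)
        hence "(\<lambda>N. ennreal (\<Sum>n<N. \<nu> (B \<inter> A n))) \<longlonglongrightarrow> ennreal (\<nu> B)" by (rule tendsto_ennrealI)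
        moreover have "ennreal (\<Sum>n<N. \<nu> (B \<inter> A n)) \<le> (suminf (\<lambda>n. f (A n)))" for N
        proof -
          have "ennreal (\<Sum>n<N. \<nu> (B \<inter> A n)) \<le> ennreal (\<Sum>n<N. max 0 (\<nu> (B \<inter> A n)))"
            by (intro ennreal_leI sum_mono) auto
          also have "\<dots> = (\<Sum>n<N. ennreal (max 0 (\<nu> (B \<inter> A n))))" by (subst sum_ennreal) auto
          also have "\<dots> \<le> (\<Sum>n<N. f (A n))"
          proof (rule sum_mono)
            fix n
            have "ennreal (\<nu> (B \<inter> A n)) \<le> f (A n)" using A B by (intro f_ub) auto
            thus "ennreal (max 0 (\<nu> (B \<inter> A n))) \<le> f (A n)" by (auto simp: max_def)
          qed
          also have "\<dots> \<le> (suminf (\<lambda>n. f (A n)))" by (intro sum_le_suminf) auto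
          finally show ?thesis .
        qed
        ultimately show ?thesis by (intro LIMSEQ_le_const2) auto
      qed
      thus "f (\<Union>n. A n) \<le> (suminf (\<lambda>n. f (A n)))" unfolding f_def[of "\<Union>n. A n"] by (intro SUP_least) auto
    qed
  qed
  moreover have "positive (sets borel) f" by (simp add: positive_def f_empty)
  moreover have "sigma_algebra UNIV (sets (borel :: real measure))"
    using sets.sigma_algebra_axioms[of borel] by simp
  moreover have "upper_variation \<nu> = measure_of UNIV (sets borel) f"
    unfolding upper_variation_def f_def ..
  ultimately have "emeasure (upper_variation \<nu>) A = f A"
    using A by (simp add: emeasure_measure_of_sigma)
  thus ?thesis by (simp add: f_def)
qed

lemma signed_integral_measure:
  assumes "finite_measure M" and M: "sets M = sets borel"
  shows "signed_borel_measure (measure M)"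
    and "signed_integral (measure M) f = integral\<^sup>L M f"
    and "signed_integrable (measure M) f \<longleftrightarrow> integrable M f"
proof -
  interpret finite_measure M by fact
  show s: "signed_borel_measure (measure M)"
    using finite_measure_UNION by (simp add: signed_borel_measure_def M)
  have s': "signed_borel_measure (\<lambda>A. - measure M A)"
    using s by (simp add: signed_borel_measure_def sums_minus)
  have sets: "sets (upper_variation \<nu>) = sets borel" for \<nu>
    unfolding upper_variation_def using sets.sigma_sets_eq[of "borel :: real measure"]
    by (simp add: sets_measure_of)
  have 1: "upper_variation (measure M) = M"
  proof (rule measure_eqI)
    fix A assume "A \<in> sets (upper_variation (measure M))"
    hence A: "A \<in> sets borel" by (simp add: sets)
    have "(SUP B\<in>{B \<in> sets borel. B \<subseteq> A}. ennreal (measure M B)) = ennreal (measure M A)"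
      using A M by (intro antisym SUP_least SUP_upper) (auto intro!: ennreal_leI finite_measure_mono)
    thus "emeasure (upper_variation (measure M)) A = emeasure M A"
      using emeasure_upper_variation[OF s A] by (simp add: emeasure_eq_measure)
  qed (simp add: sets M)
  have 2: "upper_variation (\<lambda>A. - measure M A) = null_measure borel"
  proof (rule measure_eqI)
    fix A assume "A \<in> sets (upper_variation (\<lambda>A. - measure M A))"
    hence A: "A \<in> sets borel" by (simp add: sets)
    have "(SUP B\<in>{B \<in> sets borel. B \<subseteq> A}. ennreal (- measure M B)) = 0"
      by (auto simp: ennreal_neg intro!: antisym SUP_least)
    thus "emeasure (upper_variation (\<lambda>A. - measure M A)) A = emeasure (null_measure borel) A"
      using emeasure_upper_variation[OF s' A] by simp
  qed (simp add: sets)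
  show "signed_integral (measure M) f = integral\<^sup>L M f"
    by (simp add: signed_integral_def 1 2)
  show "signed_integrable (measure M) f \<longleftrightarrow> integrable M f"
  proof -
    have "integrable (null_measure borel) f" if "f \<in> borel_measurable borel"
      using that by (auto simp: integrable_iff_bounded)
    moreover have "f \<in> borel_measurable borel" if "integrable M f"
      using borel_measurable_integrable[OF that] measurable_cong_sets[OF M refl] by blast
    ultimately show ?thesis by (auto simp: signed_integrable_def 1 2)
  qed
qed

lemma bmult_lower:
  assumes "\<And>i j. i < j \<Longrightarrow> A i j = 0"
  shows "(A \<odot> B) i j = (\<Sum>k\<le>i. A i k ** B k j)"
proof -
  have "{k. A i k ** B k j \<noteq> 0} \<subseteq> {..i}"
  proof clarify
    fix k assume "A i k ** B k j \<noteq> 0"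
    thus "k \<le> i" using assms[of i k] by (cases "i < k") auto
  qed
  thus ?thesis unfolding bmult_def by (intro Sum_any.expand_superset) auto
qed

lemma sum_matrix_mult:
  fixes X :: "real^'p^'p::finite"
  shows "(\<Sum>k\<in>I. f k) ** X = (\<Sum>k\<in>I. f k ** X)"
    and "X ** (\<Sum>k\<in>I. f k) = (\<Sum>k\<in>I. X ** f k)"
proof -
  have distrib: "(A + B) ** X = A ** X + B ** X" for A B :: "real^'p^'p"
    by (simp add: matrix_matrix_mult_def vec_eq_iff sum.distrib distrib_right)
  show "(\<Sum>k\<in>I. f k) ** X = (\<Sum>k\<in>I. f k ** X)"
    by (induction I rule: infinite_finite_induct) (simp_all add: distrib)
  show "X ** (\<Sum>k\<in>I. f k) = (\<Sum>k\<in>I. X ** f k)"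
    by (induction I rule: infinite_finite_induct) (simp_all add: matrix_add_ldistrib)
qed

lemma bmult_assoc_lower:
  assumes A: "\<And>i j. i < j \<Longrightarrow> A i j = 0" and B: "\<And>i j. i < j \<Longrightarrow> B i j = 0"
  shows "(A \<odot> B) \<odot> C = A \<odot> (B \<odot> C)"
proof (intro ext)
  fix i j
  have AB: "(A \<odot> B) i k = 0" if "i < k" for i k
    using that by (simp add: bmult_lower[OF A] B)
  have ext: "(\<Sum>k\<le>l. B l k ** C k j) = (\<Sum>k\<le>i. B l k ** C k j)" if "l \<le> i" for l
    using that by (intro sum.mono_neutral_left) (auto simp: B)
  have "((A \<odot> B) \<odot> C) i j = (\<Sum>k\<le>i. \<Sum>l\<le>i. A i l ** B l k ** C k j)"
    by (simp add: bmult_lower[OF A] bmult_lower[OF AB] sum_matrix_mult)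
  also have "\<dots> = (\<Sum>l\<le>i. \<Sum>k\<le>i. A i l ** (B l k ** C k j))"
    by (subst sum.swap) (simp add: matrix_mul_assoc)
  also have "\<dots> = (A \<odot> (B \<odot> C)) i j"
    by (simp add: bmult_lower[OF A] bmult_lower[OF B] ext sum_matrix_mult)
  finally show "((A \<odot> B) \<odot> C) i j = (A \<odot> (B \<odot> C)) i j" .
qed

lemma binverse_lower_unitriangular:
  assumes S: "lower_unitriangular S"
  shows "S \<odot> binverse S = bident" and "binverse S \<odot> S = bident"
    and "lower_unitriangular (binverse S)"
proof -
  have bident0: "i < j \<Longrightarrow> bident i j = 0" for i j by (simp add: bident_def)
  have low: "i < j \<Longrightarrow> T i j = 0" if "lower_unitriangular T" for T :: "'a block_matrix" and i j
    using that by (simp add: lower_unitriangular_def)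
  have left_id: "bident \<odot> B = B" for B :: "'a block_matrix"
    by (intro ext) (simp add: bmult_lower[OF bident0] bident_def if_distrib[of "\<lambda>x. x ** _"] cong: if_cong)
  have right_id: "T \<odot> bident = T" if "lower_unitriangular T" for T :: "'a block_matrix"
    using low[OF that]
    by (intro ext) (auto simp: bmult_lower[OF low[OF that]] bident_def if_distrib[of "\<lambda>x. _ ** x"] cong: if_cong)
  have right_inverse: "\<exists>R. lower_unitriangular R \<and> T \<odot> R = bident"
    if T: "lower_unitriangular T" for T :: "'a block_matrix"
  proof -
    have "\<exists>R. \<forall>i. R i = (\<lambda>j. bident i j - (\<Sum>k<i. T i k ** R k j))"
    proof (rule dependent_wf_choice[OF wf_less_than])
      fix R R' :: "'a block_matrix" and i r
      assume eq: "\<And>k. (k, i) \<in> less_than \<Longrightarrow> R k = R' k"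
      have "(\<Sum>k<i. T i k ** R k j) = (\<Sum>k<i. T i k ** R' k j)" for j
        by (rule sum.cong) (simp_all add: eq)
      thus "(r = (\<lambda>j. bident i j - (\<Sum>k<i. T i k ** R k j))) =
            (r = (\<lambda>j. bident i j - (\<Sum>k<i. T i k ** R' k j)))" by simp
    qed (rule exI, rule refl)
    then obtain R where "\<forall>i. R i = (\<lambda>j. bident i j - (\<Sum>k<i. T i k ** R k j))" ..
    note R = fun_cong[OF this[rule_format]]
    have R0: "i < j \<Longrightarrow> R i j = 0" for i j
    proof (induction i rule: less_induct)
      case (less i)
      hence "(\<Sum>k<i. T i k ** R k j) = 0" by (intro sum.neutral) simp
      thus ?case using R[of i j] less.prems by (simp add: bident_def)
    qed
    have "R i i = mat 1" for i
    proof -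
      have "(\<Sum>k<i. T i k ** R k i) = 0" by (intro sum.neutral) (simp add: R0)
      thus ?thesis using R[of i i] by (simp add: bident_def)
    qed
    hence "lower_unitriangular R" using R0 by (simp add: lower_unitriangular_def)
    moreover have "T \<odot> R = bident"
    proof (intro ext)
      fix i j
      have "(T \<odot> R) i j = (\<Sum>k<i. T i k ** R k j) + R i j"
        using T by (simp add: bmult_lower[OF low[OF T]] lessThan_Suc_atMost[symmetric]
            lower_unitriangular_def)
      thus "(T \<odot> R) i j = bident i j" using R[of i j] by simp
    qed
    ultimately show ?thesis by blast
  qed
  obtain R where R: "lower_unitriangular R" "S \<odot> R = bident" using right_inverse[OF S] by blast
  obtain T where T: "lower_unitriangular T" "R \<odot> T = bident" using right_inverse[OF R(1)] by blast
  have assoc: "T \<odot> U \<odot> V = T \<odot> (U \<odot> V)"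
    if "lower_unitriangular T" "lower_unitriangular U" for T U V :: "'a block_matrix"
    using low[OF that(1)] low[OF that(2)] by (rule bmult_assoc_lower)
  have "S = T"
    using assoc[OF S R(1), of T] by (simp add: R(2) T(2) left_id right_id[OF S])
  hence RS: "R \<odot> S = bident" using T(2) by simp
  have unique: "B = R" if "S \<odot> B = bident" for B
    using assoc[OF R(1) S, of B] by (simp add: RS that left_id right_id[OF R(1)])
  have "binverse S = R"
    unfolding binverse_def using R(2) RS by (intro the_equality conjI) (auto elim: unique)
  thus "S \<odot> binverse S = bident" "binverse S \<odot> S = bident"
    "lower_unitriangular (binverse S)"
    using R RS by simp_all
qed

end

(* The blocks of \<chi>(x) are scalar multiples of the identity, so W(\<Lambda>) \<chi>(x) = \<chi>(x) W(x).
   Both identities follow by cancelling S_i^{-1} S_i, as products of row-finite block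
   matrices are associative. *)

theory Submission
  imports Defs
begin

text \<open>This class holds both the triangular factors and the banded
  \<open>mpoly_shift W\<close>, and it is closed under products. It is needed because
  \<open>\<omega>\<^sub>1\<close> is in general not lower triangular, so that
  \<open>bmult_assoc_lower\<close> does not cover it.\<close>

definition row_finite :: "'p::finite block_matrix \<Rightarrow> bool" where
  "row_finite A \<longleftrightarrow> (\<forall>i. finite {k. A i k \<noteq> 0})"

lemma row_finiteI:
  assumes "\<And>i k. f i < k \<Longrightarrow> A i k = 0"
  shows "row_finite A"
  unfolding row_finite_def
proof
  fix i
  have "{k. A i k \<noteq> 0} \<subseteq> {..f i}" using assms[of i] by (auto simp: not_less[symmetric])
  thus "finite {k. A i k \<noteq> 0}" by (rule finite_subset) simp
qed

lemma row_finite_bound: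
  assumes "row_finite A"
  obtains n where "\<And>k. n < k \<Longrightarrow> A i k = 0"
proof -
  have "finite {k. A i k \<noteq> 0}" using assms by (simp add: row_finite_def)
  then obtain n where "\<forall>k\<in>{k. A i k \<noteq> 0}. k \<le> n" by (auto simp: finite_nat_set_iff_bounded_le)
  hence "n < k \<Longrightarrow> A i k = 0" for k by (meson leD mem_Collect_eq)
  thus ?thesis by (rule that)
qed

lemma row_finite_lower_unitriangular: "lower_unitriangular S \<Longrightarrow> row_finite S"
  by (rule row_finiteI[of "\<lambda>i. i"]) (simp add: lower_unitriangular_def)

text \<open>\<open>Sum_any\<close> is 0 by convention on infinite supports. A bound on row
  \<open>i\<close> of \<open>A\<close> alone makes the support finite, whatever \<open>v\<close>
  is.\<close>

lemma bmult_vec_eq_sum: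
  assumes "\<And>k. n < k \<Longrightarrow> A i k = 0"
  shows "(A \<odot>v v) i = (\<Sum>k\<le>n. A i k ** v k)"
  unfolding bmult_vec_def
proof (rule Sum_any.expand_superset)
  show "{k. A i k ** v k \<noteq> 0} \<subseteq> {..n}"
    using assms by (auto simp: not_less[symmetric])
qed simp

lemma bmult_eq_sum:
  assumes "\<And>k. n < k \<Longrightarrow> A i k = 0"
  shows "(A \<odot> B) i j = (\<Sum>k\<le>n. A i k ** B k j)"
  \<comment> \<open>Column \<open>j\<close> of \<open>B\<close> is itself a block vector.\<close>
  using bmult_vec_eq_sum[of n A i "\<lambda>k. B k j", OF assms] by (simp add: bmult_def bmult_vec_def)

text \<open>Row \<open>i\<close> of the product combines finitely many rows of \<open>B\<close>,
  each of finite support.\<close>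

lemma row_finite_bmult:
  assumes A: "row_finite A" and B: "row_finite B"
  shows "row_finite (A \<odot> B)"
  unfolding row_finite_def
proof
  fix i
  obtain n where n: "\<And>k. n < k \<Longrightarrow> A i k = 0" using row_finite_bound[OF A] by metis
  have "{j. (A \<odot> B) i j \<noteq> 0} \<subseteq> (\<Union>k\<le>n. {j. B k j \<noteq> 0})"
  proof
    fix j assume "j \<in> {j. (A \<odot> B) i j \<noteq> 0}"
    hence "(\<Sum>k\<le>n. A i k ** B k j) \<noteq> 0"
      by (simp add: bmult_eq_sum[of n A, OF n])
    then obtain k where "k \<le> n" "A i k ** B k j \<noteq> 0" by (meson atMost_iff sum.neutral)
    moreover from this have "B k j \<noteq> 0" by auto
    ultimately show "j \<in> (\<Union>k\<le>n. {j. B k j \<noteq> 0})" by blast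
  qed
  moreover have "finite (\<Union>k\<le>n. {j. B k j \<noteq> 0})" using B by (simp add: row_finite_def)
  ultimately show "finite {j. (A \<odot> B) i j \<noteq> 0}" by (rule finite_subset)
qed

text \<open>Both sides are the same double sum over a finite rectangle of indices, so the order of
  summation can be exchanged for arbitrary \<open>v\<close>.\<close>

lemma bmult_vec_assoc:
  assumes A: "row_finite A" and B: "row_finite B"
  shows "(A \<odot> B) \<odot>v v = A \<odot>v (B \<odot>v v)"
proof
  fix i
  obtain n where n: "\<And>k. n < k \<Longrightarrow> A i k = 0" using row_finite_bound[OF A] by metis
  \<comment> \<open>One finite column set that serves all rows of \<open>B\<close> reached from row
    \<open>i\<close> of \<open>A\<close>.\<close>
  define J where "J = (\<Union>k\<le>n. {j. B k j \<noteq> 0})"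
  have J: "finite J" using B by (simp add: J_def row_finite_def)
  have AB: "(A \<odot> B) i j = (\<Sum>k\<le>n. A i k ** B k j)" for j
    by (simp add: bmult_eq_sum[of n A, OF n])
  have AB0: "(A \<odot> B) i j = 0" if "j \<notin> J" for j
    unfolding AB using that by (intro sum.neutral) (auto simp: J_def)
  have Bv: "(B \<odot>v v) k = (\<Sum>j\<in>J. B k j ** v j)" if "k \<le> n" for k
    unfolding bmult_vec_def using that J
    by (intro Sum_any.expand_superset) (auto simp: J_def)
  have "((A \<odot> B) \<odot>v v) i = (\<Sum>j\<in>J. (A \<odot> B) i j ** v j)"
    unfolding bmult_vec_def
  proof (rule Sum_any.expand_superset[OF J])
    show "{j. (A \<odot> B) i j ** v j \<noteq> 0} \<subseteq> J" using AB0 by fastforce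
  qed
  also have "\<dots> = (\<Sum>k\<le>n. \<Sum>j\<in>J. A i k ** (B k j ** v j))"
    by (subst sum.swap) (simp add: AB sum_matrix_mult(1) matrix_mul_assoc)
  also have "\<dots> = (\<Sum>k\<le>n. A i k ** (B \<odot>v v) k)"
    by (simp add: Bv sum_matrix_mult(2))
  also have "\<dots> = (A \<odot>v (B \<odot>v v)) i"
    by (simp add: bmult_vec_eq_sum[of n A, OF n])
  finally show "((A \<odot> B) \<odot>v v) i = (A \<odot>v (B \<odot>v v)) i" .
qed

lemma bident_bmult_vec: "bident \<odot>v v = v"
proof
  fix i
  have "(bident \<odot>v v) i = (\<Sum>k\<le>i. bident i k ** v k)"
    by (rule bmult_vec_eq_sum) (simp add: bident_def)
  also have "\<dots> = v i"
    by (simp add: bident_def if_distrib[of "\<lambda>x. x ** _"] cong: if_cong)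
  finally show "(bident \<odot>v v) i = v i" .
qed

lemma binverse_bmult_vec_cancel:
  assumes "lower_unitriangular S"
  shows "binverse S \<odot>v (S \<odot>v v) = v"
  using assms
  by (simp add: bmult_vec_assoc[symmetric] row_finite_lower_unitriangular
      binverse_lower_unitriangular bident_bmult_vec)

text \<open>Multiplying by \<open>bshift\<close> on the left replaces row \<open>i\<close> by row
  \<open>Suc i\<close>; hence the induction is over arbitrary \<open>i\<close>.\<close>

lemma bpower_bshift:
  "(bpower bshift j :: 'p::finite block_matrix) i k = (if k = i + j then mat 1 else 0)"
proof (induction j arbitrary: i)
  case (Suc j)
  have "(bpower bshift (Suc j) :: 'p block_matrix) i k = (\<Sum>l\<le>Suc i. bshift i l ** bpower bshift j l k)"
    unfolding bpower.simps by (rule bmult_eq_sum) (simp add: bshift_def)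
  also have "\<dots> = bpower bshift j (Suc i) k"
    by (simp add: bshift_def if_distrib[of "\<lambda>x. x ** _"] cong: if_cong)
  finally show ?case by (simp add: Suc.IH del: bpower.simps)
qed (simp add: bident_def)

lemma bdiag_bmult: "(bdiag A \<odot> B) i j = A ** B i j"
proof -
  have "(bdiag A \<odot> B) i j = (\<Sum>k\<le>i. bdiag A i k ** B k j)"
    by (rule bmult_lower) (simp add: bdiag_def)
  also have "\<dots> = A ** B i j"
    by (simp add: bdiag_def if_distrib[of "\<lambda>x. x ** _"] cong: if_cong)
  finally show ?thesis .
qed

text \<open>At most one summand is nonzero. The sum form is kept so that it can be interchanged with
  the sum over \<open>k\<close> when \<open>monomials x\<close> is applied.\<close>

lemma mpoly_shift_eq:
  "mpoly_shift W i k = (\<Sum>j\<le>degree W. if k = i + j then coeff W j else 0)"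
  unfolding mpoly_shift_def
  by (rule sum.cong) (simp_all add: bdiag_bmult bpower_bshift)

lemma row_finite_mpoly_shift: "row_finite (mpoly_shift W)"
  by (rule row_finiteI[of "\<lambda>i. i + degree W"]) (auto simp: mpoly_shift_eq intro!: sum.neutral)

lemma mpoly_shift_monomials:
  "mpoly_shift W \<odot>v monomials x = (\<lambda>n. monomials x n ** mpoly_eval W x)"
proof
  fix n
  let ?D = "degree W"
  \<comment> \<open>Row \<open>n\<close> of the band matrix vanishes beyond column
    \<open>n + degree W\<close>.\<close>
  have "(mpoly_shift W \<odot>v monomials x) n = (\<Sum>k\<le>n + ?D. mpoly_shift W n k ** monomials x k)"
    by (rule bmult_vec_eq_sum) (auto simp: mpoly_shift_eq intro!: sum.neutral)
  also have "\<dots> = (\<Sum>j\<le>?D. \<Sum>k\<le>n + ?D. if k = n + j then x ^ k *\<^sub>R coeff W j else 0)"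
    by (subst sum.swap)
      (simp add: mpoly_shift_eq monomials_def sum_matrix_mult(1) matrix_scalar_ac scalar_matrix_assoc[symmetric]
        scaleR_sum_right if_distrib[of "\<lambda>y. _ *\<^sub>R y"] cong: if_cong)
  \<comment> \<open>The index \<open>k = n + j\<close> lies in the range of the inner sum because
    \<open>j\<close> is at most the degree.\<close>
  also have "\<dots> = (\<Sum>j\<le>?D. x ^ (n + j) *\<^sub>R coeff W j)"
    by (intro sum.cong) auto
  also have "\<dots> = monomials x n ** mpoly_eval W x"
    by (simp add: monomials_def mpoly_eval_def scaleR_sum_right power_add
        scalar_matrix_assoc[symmetric])
  finally show "(mpoly_shift W \<odot>v monomials x) n = monomials x n ** mpoly_eval W x" .
qed

text \<open>This moves the factor \<open>W(x)\<close> out to the right of \<open>S\<^sub>1'\<close>.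
  Finite rows matter: a singular \<open>X\<close> could otherwise turn an infinite support, with
  \<open>Sum_any\<close> equal to 0, into a finite one.\<close>

lemma bmult_vec_mult_right:
  assumes A: "row_finite A"
  shows "A \<odot>v (\<lambda>n. v n ** X) = (\<lambda>n. (A \<odot>v v) n ** X)"
proof
  fix i
  obtain n where n: "\<And>k. n < k \<Longrightarrow> A i k = 0" using row_finite_bound[OF A] by metis
  show "(A \<odot>v (\<lambda>n. v n ** X)) i = (A \<odot>v v) i ** X"
    by (simp add: bmult_vec_eq_sum[of n A, OF n] sum_matrix_mult(1) matrix_mul_assoc)
qed

theorem proposition18:
  fixes \<mu> :: "(real set \<Rightarrow> real)^'p::finite^'p"
    and W :: "(real^'p^'p) poly" and N :: nat
    and S\<^sub>1 S\<^sub>2 H S\<^sub>1' S\<^sub>2' H' \<omega>\<^sub>1 \<omega>\<^sub>2 :: "'p block_matrix"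
    and P\<^sub>1 P\<^sub>2 P\<^sub>1' P\<^sub>2' :: "real \<Rightarrow> 'p block_vector"
  assumes "matrix_measure \<mu>" and "finite_moments \<mu>"
    and "monic_mpoly W N"
    and "gauss_borel (moment_matrix \<mu>) S\<^sub>1 H S\<^sub>2"
    and "gauss_borel (perturbed_moment_matrix W \<mu>) S\<^sub>1' H' S\<^sub>2'"
    and "\<And>x. P\<^sub>1 x = S\<^sub>1 \<odot>v monomials x" and "\<And>x. P\<^sub>2 x = S\<^sub>2 \<odot>v monomials x"
    and "\<And>x. P\<^sub>1' x = S\<^sub>1' \<odot>v monomials x" and "\<And>x. P\<^sub>2' x = S\<^sub>2' \<odot>v monomials x"
    and "\<omega>\<^sub>1 = S\<^sub>1' \<odot> mpoly_shift W \<odot> binverse S\<^sub>1"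
    and "\<omega>\<^sub>2 = btranspose (S\<^sub>2 \<odot> binverse S\<^sub>2')"
  shows "(\<forall>x. \<omega>\<^sub>1 \<odot>v P\<^sub>1 x = (\<lambda>n. P\<^sub>1' x n ** mpoly_eval W x)) \<and>
         (\<forall>x. P\<^sub>2 x = btranspose \<omega>\<^sub>2 \<odot>v P\<^sub>2' x)"
proof (intro conjI allI)
  note lu = assms(4,5)[unfolded gauss_borel_def]
  have S: "lower_unitriangular S\<^sub>1" "lower_unitriangular S\<^sub>1'"
    "lower_unitriangular S\<^sub>2" "lower_unitriangular S\<^sub>2'"
    using lu by blast+
  \<comment> \<open>The inverses are again unitriangular, so all eight matrices have finite
    rows.\<close>
  note rf = S[THEN row_finite_lower_unitriangular]
    S[THEN binverse_lower_unitriangular(3), THEN row_finite_lower_unitriangular]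
  fix x
  \<comment> \<open>Reassociation places \<open>binverse S\<^sub>1\<close> directly before
    \<open>S\<^sub>1\<close>.\<close>
  have "\<omega>\<^sub>1 \<odot>v P\<^sub>1 x = S\<^sub>1' \<odot>v (mpoly_shift W \<odot>v (binverse S\<^sub>1 \<odot>v (S\<^sub>1 \<odot>v monomials x)))"
    by (simp add: assms(6,10) bmult_vec_assoc row_finite_bmult row_finite_mpoly_shift rf)
  also have "\<dots> = S\<^sub>1' \<odot>v (\<lambda>n. monomials x n ** mpoly_eval W x)"
    by (simp add: binverse_bmult_vec_cancel S mpoly_shift_monomials)
  also have "\<dots> = (\<lambda>n. P\<^sub>1' x n ** mpoly_eval W x)"
    by (simp add: assms(8) bmult_vec_mult_right rf)
  finally show "\<omega>\<^sub>1 \<odot>v P\<^sub>1 x = (\<lambda>n. P\<^sub>1' x n ** mpoly_eval W x)" .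
  \<comment> \<open>The two block transposes cancel, and \<open>binverse S\<^sub>2'\<close> then
    cancels the \<open>S\<^sub>2'\<close> contained in \<open>P\<^sub>2'\<close>.\<close>
  have "btranspose \<omega>\<^sub>2 = S\<^sub>2 \<odot> binverse S\<^sub>2'"
    by (simp add: assms(11) btranspose_def)
  thus "P\<^sub>2 x = btranspose \<omega>\<^sub>2 \<odot>v P\<^sub>2' x"
    by (simp add: assms(7,9) bmult_vec_assoc rf binverse_bmult_vec_cancel S)
qed

end
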